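(* Let $q,z\in\mathbb{C}$ with $|q|<1$ and $z\neq 0$. Then $$\sum_{n\in\mathbb{Z}}(-1)^n z^n q^{n(n-1)/2}=\prod_{m=1}^{\infty}(1-q^m)(1-zq^{m-1})(1-z^{-1}q^m).$$
   Context: The bilateral sum and the infinite product are taken in $\mathbb{C}$ with its usual topology. Convention: $0^0=1$ (relevant only when $q=0$). *)

theory Defs
  imports "HOL-Analysis.Analysis"
begin

end

theory Submission
  imports Defs
begin

text \<open>
  The product of the first N factors 1 - z q^i and the first N factors 1 - q^(i+1)/z is the finite
  sum of (-1)^n z^n q^(n(n-1)/2) times the Gaussian binomial of 2N over N + n. Gaussian binomials
  are bounded uniformly because the partial products of (q; q) converge to a nonzero limit L, and
  these central ones tend to 1/L. Multiplying by the N-th partial product of (q; q) and passing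
  to the limit by Tannery's theorem, separately for n \<ge> 0 and n < 0, cancels L.
\<close>

text \<open>Gaussian binomials by Pascal's rule rather than as quotients, so that no division by
  1 - q^k occurs in the algebraic identities.\<close>

fun qbinom :: "'a::comm_ring_1 \<Rightarrow> nat \<Rightarrow> nat \<Rightarrow> 'a" where
  "qbinom q m 0 = 1"
| "qbinom q 0 (Suc k) = 0"
| "qbinom q (Suc m) (Suc k) = qbinom q m k + q ^ Suc k * qbinom q m (Suc k)"

text \<open>The q-Pochhammer symbol \<open>(q; q)_n\<close>.\<close>

definition qpoch :: "'a::comm_ring_1 \<Rightarrow> nat \<Rightarrow> 'a" where
  "qpoch q n = (\<Prod>i<n. 1 - q ^ Suc i)"

lemma qbinom_eq_0: "m < k \<Longrightarrow> qbinom q m k = 0"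
  by (induction q m k rule: qbinom.induct) auto

lemma qbinom_self: "qbinom q m m = 1"
  by (induction m) (auto simp: qbinom_eq_0)

text \<open>Pascal's rule and induction on \<open>a + b\<close>: the two summands contribute the
  weights \<open>1 - q ^ a\<close> and \<open>q ^ a * (1 - q ^ b)\<close>, which add up to
  \<open>1 - q ^ (a + b)\<close>.\<close>

lemma qbinom_mult_qpoch: "qbinom q (a + b) a * (qpoch q a * qpoch q b) = qpoch q (a + b)"
proof (induction "a + b" arbitrary: a b)
  case 0
  then show ?case by (simp add: qpoch_def)
next
  case (Suc n)
  show ?case
  proof (cases a)
    case 0
    then show ?thesis by (simp add: qpoch_def)
  next
    case a: (Suc a')
    show ?thesis
    proof (cases b)
      case 0
      then show ?thesis by (simp add: qpoch_def qbinom_self)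
    next
      case b: (Suc b')
      have Suc_poch: "qpoch q (Suc k) = qpoch q k * (1 - q ^ Suc k)" for k
        by (simp add: qpoch_def)
      have 1: "qbinom q (a' + b) a' * (qpoch q a' * qpoch q b) = qpoch q (a' + b)"
        and 2: "qbinom q (a + b') a * (qpoch q a * qpoch q b') = qpoch q (a + b')"
        using Suc(1)[of a' b] Suc(1)[of a b'] Suc(2) a b by auto
      have ab: "a + b = Suc (a' + b)" "a + b' = a' + b" using a b by auto
      have "qbinom q (a + b) a * (qpoch q a * qpoch q b)
          = (1 - q ^ a) * (qbinom q (a' + b) a' * (qpoch q a' * qpoch q b))
            + q ^ a * (1 - q ^ b) * (qbinom q (a + b') a * (qpoch q a * qpoch q b'))"
        unfolding ab unfolding a b qbinom.simps Suc_poch by (simp add: algebra_simps)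
      also have "\<dots> = qpoch q (a' + b) * (1 - q ^ a * q ^ b)"
        unfolding 1 2 unfolding ab by (simp add: algebra_simps)
      also have "\<dots> = qpoch q (a + b)"
        unfolding ab Suc_poch by (simp add: a power_add mult.assoc)
      finally show ?thesis .
    qed
  qed
qed

section \<open>Terms of the bilateral series\<close>

definition theta_term :: "complex \<Rightarrow> complex \<Rightarrow> int \<Rightarrow> complex" where
  "theta_term q z n = (-1) powi n * z powi n * q ^ nat (n * (n - 1) div 2)"

lemma nat_triangle: "nat (int n * (int n - 1) div 2) = n * (n - 1) div 2"
proof (cases n)
  case (Suc m)
  then have "int n * (int n - 1) div 2 = int (n * (n - 1) div 2)"
    by (simp add: zdiv_int algebra_simps)
  then show ?thesis by simp
qed simp

lemma theta_term_of_nat: "theta_term q z (int n) = (- z) ^ n * q ^ (n * (n - 1) div 2)"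
  unfolding theta_term_def nat_triangle by (simp add: power_int_def flip: power_mult_distrib)

lemma triangle_Suc: "Suc n * (Suc n - 1) div 2 = n * (n - 1) div 2 + n"
proof -
  have "Suc n * (Suc n - 1) = n * (n - 1) + 2 * n" by (cases n) auto
  then show ?thesis by simp
qed

text \<open>The triangular exponent at \<open>- n\<close> exceeds the one at \<open>n\<close> by
  \<open>n\<close>, and the extra \<open>q ^ n\<close> merges with \<open>z powi (- n)\<close> into
  a power of \<open>q / z\<close>. Thus the negative half of the series becomes one over natural
  indices.\<close>

lemma theta_term_minus:
  assumes "z \<noteq> 0"
  shows "theta_term q z (- int n) = theta_term q (q / z) (int n)"
proof -
  have "- int n * (- int n - 1) = int (Suc n * (Suc n - 1))"
    by (simp add: algebra_simps)
  then have "nat (- int n * (- int n - 1) div 2) = Suc n * (Suc n - 1) div 2"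
    by (metis zdiv_int nat_int of_nat_numeral)
  then have e: "nat (- int n * (- int n - 1) div 2) = n * (n - 1) div 2 + n"
    by (simp only: triangle_Suc)
  show ?thesis
    unfolding theta_term_of_nat
    unfolding theta_term_def e
    using assms by (simp add: power_int_minus power_add field_simps power_minus[of "q/z"] power_divide)
qed

text \<open>Passing from \<open>j - 1\<close> to \<open>j\<close> raises the triangular exponent by
  \<open>j - 1\<close>, which may be negative. The factor \<open>q ^ n\<close> on the left keeps all
  exponents natural, so that \<open>q = 0\<close> is covered.\<close>

lemma theta_term_pred:
  assumes "z \<noteq> 0" and "j + int n \<ge> 1"
  shows "theta_term q z j * q ^ n = - z * theta_term q z (j - 1) * q ^ nat (j - 1 + int n)"
proof -
  have nn: "m * (m - 1) div 2 \<ge> 0" for m :: int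
    by (cases "m \<ge> 1") (auto simp: mult_nonpos_nonpos)
  have "j * (j - 1) = (j - 1) * (j - 1 - 1) + 2 * (j - 1)"
    by (simp add: algebra_simps)
  then have "j * (j - 1) div 2 + int n = (j - 1) * (j - 1 - 1) div 2 + (j - 1 + int n)"
    by simp
  then have "nat (j * (j - 1) div 2) + n = nat ((j - 1) * (j - 1 - 1) div 2) + nat (j - 1 + int n)"
    using nn[of j] nn[of "j - 1"] assms(2) by linarith
  then have q: "q ^ nat (j * (j - 1) div 2) * q ^ n
      = q ^ nat ((j - 1) * (j - 1 - 1) div 2) * q ^ nat (j - 1 + int n)"
    by (simp flip: power_add)
  have z: "z powi j = z * z powi (j - 1)" "(-1::complex) powi j = - ((-1) powi (j - 1))"
    using assms(1) by (simp_all add: power_int_diff)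
  have "theta_term q z j * q ^ n
      = (-1) powi j * z powi j * (q ^ nat (j * (j - 1) div 2) * q ^ n)"
    by (simp add: theta_term_def)
  also have "\<dots> = - z * theta_term q z (j - 1) * q ^ nat (j - 1 + int n)"
    unfolding q z theta_term_def by simp
  finally show ?thesis .
qed

section \<open>Finite product identities\<close>

text \<open>Induction with \<open>z\<close> arbitrary: once the factor \<open>1 - z\<close> is split
  off, the rest is the shorter product at \<open>z * q\<close>, and Pascal's rule recombines
  neighbouring coefficients.\<close>

lemma q_binomial_theorem:
  "(\<Prod>i<M. 1 - z * q ^ i) = (\<Sum>k\<le>M. theta_term q z (int k) * qbinom q M k)"
proof (induction M arbitrary: z)
  case 0
  then show ?case by (simp add: theta_term_def)
next
  case (Suc M)
  have shift: "theta_term q (z * q) (int k) = theta_term q z (int k) * q ^ k" for k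
    using power_mult_distrib[of "- z" q k] by (simp add: theta_term_of_nat)
  have step: "theta_term q z (int (Suc k)) = - z * q ^ k * theta_term q z (int k)" for k
    unfolding theta_term_of_nat triangle_Suc by (simp add: power_add)
  define f where "f k = theta_term q z (int k) * q ^ k * qbinom q M k" for k
  have f_Suc: "f (Suc M) = 0"
    by (simp add: f_def qbinom_eq_0)
  have pascal: "f (Suc k) - z * f k = theta_term q z (int (Suc k)) * qbinom q (Suc M) (Suc k)" for k
    by (simp add: f_def step algebra_simps del: of_nat_Suc)
  have "(\<Prod>i<Suc M. 1 - z * q ^ i) = (1 - z) * (\<Prod>i<M. 1 - z * q * q ^ i)"
    unfolding prod.lessThan_Suc_shift by (simp add: mult.assoc)
  also have "\<dots> = (1 - z) * (\<Sum>k\<le>M. f k)"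
    unfolding Suc.IH by (simp add: shift f_def)
  also have "\<dots> = (\<Sum>k\<le>Suc M. f k) + (\<Sum>k\<le>M. - z * f k)"
    by (simp add: f_Suc left_diff_distrib sum_subtractf sum_negf sum_distrib_left)
  also have "\<dots> = f 0 + (\<Sum>k\<le>M. f (Suc k) - z * f k)"
    unfolding sum.atMost_Suc_shift by (simp add: sum.distrib sum_subtractf sum_negf)
  also have "\<dots> = (\<Sum>k\<le>Suc M. theta_term q z (int k) * qbinom q (Suc M) k)"
    unfolding sum.atMost_Suc_shift pascal by (simp add: f_def)
  finally show ?case .
qed

text \<open>Separate M and N allow an induction on N alone, starting from the q-binomial theorem. The usual
  substitution of z / q^N for z in that theorem would exclude q = 0.\<close>

lemma finite_jacobi_triple_product:
  assumes z: "z \<noteq> 0"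
  shows "(\<Prod>i<M. 1 - z * q ^ i) * (\<Prod>i<N. 1 - q ^ Suc i / z)
    = (\<Sum>k\<le>M + N. theta_term q z (int k - int N) * qbinom q (M + N) k)"
proof (induction N)
  case 0
  then show ?case by (simp add: q_binomial_theorem)
next
  case (Suc N)
  define L where "L = M + N"
  define t where "t k = theta_term q z (int k - int (Suc N))" for k
  have t_Suc: "theta_term q z (int k - int N) = t (Suc k)" for k
    by (simp add: t_def)
  \<comment> \<open>The new factor's second term lowers the index of \<open>t\<close> by one and
    leaves exactly the power \<open>q ^ k\<close> that Pascal's rule asks for.\<close>
  have step: "t (Suc k) * q ^ Suc N / z = - t k * q ^ k" for k
    using theta_term_pred[of z "int k - int N" "Suc N" q] z by (simp add: t_def field_simps)
  have "(\<Prod>i<M. 1 - z * q ^ i) * (\<Prod>i<Suc N. 1 - q ^ Suc i / z)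
      = (\<Sum>k\<le>L. t (Suc k) * qbinom q L k) * (1 - q ^ Suc N / z)"
    using Suc.IH by (simp add: L_def t_Suc mult.assoc)
  also have "\<dots> = (\<Sum>k\<le>L. t (Suc k) * qbinom q L k)
      - (\<Sum>k\<le>L. (t (Suc k) * q ^ Suc N / z) * qbinom q L k)"
    unfolding right_diff_distrib sum_distrib_right by (simp add: ac_simps)
  \<comment> \<open>The top index \<open>Suc L\<close> adds nothing, as
    \<open>qbinom q L (Suc L) = 0\<close>.\<close>
  also have "\<dots> = (\<Sum>k\<le>L. t (Suc k) * qbinom q L k) + (\<Sum>k\<le>Suc L. t k * q ^ k * qbinom q L k)"
    unfolding step by (simp add: sum_negf qbinom_eq_0)
  also have "\<dots> = (\<Sum>k\<le>Suc L. t k * qbinom q (Suc L) k)"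
    unfolding sum.atMost_Suc_shift by (simp add: sum.distrib algebra_simps)
  finally show ?case by (simp add: t_def L_def)
qed

section \<open>Bounds and limits of Gaussian binomials\<close>

lemma abs_convergent_prod_one_minus_geometric:
  fixes q :: complex
  assumes "norm q < 1"
  shows "abs_convergent_prod (\<lambda>m. 1 - c * q ^ m)"
  using assms by (intro summable_imp_abs_convergent_prod)
    (simp add: norm_mult norm_power summable_geometric)

lemma qpoch_nonzero:
  fixes q :: complex
  assumes "norm q < 1"
  shows "qpoch q n \<noteq> 0"
proof -
  have "norm (q ^ Suc i) < 1" for i
    unfolding norm_power using assms by (subst power_less_one_iff) auto
  then have "1 - q ^ Suc i \<noteq> 0" for i
    by (metis norm_one less_irrefl right_minus_eq)
  then show ?thesis
    unfolding qpoch_def by (subst prod_zero_iff) auto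
qed

lemma qbinom_eq_quotient:
  fixes q :: complex
  assumes "norm q < 1" "k \<le> m"
  shows "qbinom q m k = qpoch q m / (qpoch q k * qpoch q (m - k))"
  using qbinom_mult_qpoch[of q k "m - k"] qpoch_nonzero[OF assms(1)] assms(2)
  by (simp add: eq_divide_eq)

text \<open>The infinite product converges absolutely and has no zero factor, so its value is
  nonzero.\<close>

lemma qpoch_convergent:
  fixes q :: complex
  assumes "norm q < 1"
  obtains L where "L \<noteq> 0" "qpoch q \<longlonglongrightarrow> L"
proof -
  have "abs_convergent_prod (\<lambda>m. 1 - q ^ Suc m)"
    using abs_convergent_prod_one_minus_geometric[OF assms, of q] by simp
  then have c: "convergent_prod (\<lambda>m. 1 - q ^ Suc m)"
    by (rule abs_convergent_prod_imp_convergent_prod)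
  have nz: "1 - q ^ Suc i \<noteq> 0" for i
    using qpoch_nonzero[OF assms, of "Suc i"] by (simp add: qpoch_def)
  have "prodinf (\<lambda>m. 1 - q ^ Suc m) \<noteq> 0"
    using prodinf_nonzero[OF c] nz by blast
  moreover have "qpoch q \<longlonglongrightarrow> prodinf (\<lambda>m. 1 - q ^ Suc m)"
    using convergent_prod_LIMSEQ[OF c] LIMSEQ_lessThan_iff_atMost[of "\<lambda>A. \<Prod>i\<in>A. 1 - q ^ Suc i"]
    unfolding qpoch_def by blast
  ultimately show ?thesis using that by blast
qed

text \<open>Since \<open>L\<close> is nonzero, both \<open>qpoch q\<close> and its inverse are
  bounded; the quotient formula does the rest.\<close>

lemma qbinom_bounded:
  fixes q :: complex
  assumes q: "norm q < 1"
  shows "\<exists>B. \<forall>m k. norm (qbinom q m k) \<le> B"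
proof -
  obtain L where L: "L \<noteq> 0" "qpoch q \<longlonglongrightarrow> L"
    using qpoch_convergent[OF q] .
  obtain C where C: "\<And>n. norm (qpoch q n) \<le> C"
    using L(2) convergent_imp_Bseq[of "qpoch q"] by (auto simp: convergent_def Bseq_def)
  have "(\<lambda>n. inverse (qpoch q n)) \<longlonglongrightarrow> inverse L"
    using L by (intro tendsto_inverse)
  then obtain D where D: "\<And>n. norm (inverse (qpoch q n)) \<le> D"
    using convergent_imp_Bseq[of "\<lambda>n. inverse (qpoch q n)"] by (auto simp: convergent_def Bseq_def)
  have C0: "C \<ge> 0" and D0: "D \<ge> 0"
    using C[of 0] D[of 0] norm_ge_zero order_trans by blast+
  have "norm (qbinom q m k) \<le> C * (D * D)" for m k
  proof (cases "k \<le> m")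
    case True
    have "norm (qbinom q m k)
        = norm (qpoch q m) * (norm (inverse (qpoch q k)) * norm (inverse (qpoch q (m - k))))"
      unfolding qbinom_eq_quotient[OF q True] by (simp add: divide_inverse flip: norm_mult)
    also have "\<dots> \<le> C * (D * D)"
      by (intro mult_mono C D) (auto simp: C0 D0)
    finally show ?thesis .
  next
    case False
    then show ?thesis using C0 D0 by (simp add: qbinom_eq_0)
  qed
  then show ?thesis by blast
qed

lemma qbinom_central_tendsto:
  fixes q :: complex
  assumes q: "norm q < 1" and L: "L \<noteq> 0" "qpoch q \<longlonglongrightarrow> L"
  shows "(\<lambda>N. qbinom q (2 * N) (N + n)) \<longlonglongrightarrow> 1 / L"
proof -
  have "(\<lambda>N. qpoch q (2 * N)) \<longlonglongrightarrow> L"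
    using LIMSEQ_subseq_LIMSEQ[OF L(2), of "\<lambda>N. 2 * N"] by (simp add: strict_mono_def o_def)
  moreover have "(\<lambda>N. qpoch q (N + n)) \<longlonglongrightarrow> L"
    using L(2) by (rule LIMSEQ_ignore_initial_segment)
  moreover have "(\<lambda>N. qpoch q (N - n)) \<longlonglongrightarrow> L"
    by (rule filterlim_compose[OF L(2) filterlim_minus_const_nat_at_top])
  ultimately have "(\<lambda>N. qpoch q (2 * N) / (qpoch q (N + n) * qpoch q (N - n))) \<longlonglongrightarrow> L / (L * L)"
    using L(1) by (intro tendsto_divide tendsto_mult) auto
  \<comment> \<open>Only for \<open>N\<close> at least \<open>n\<close> is \<open>N - n\<close> the
    true complementary index.\<close>
  moreover have "\<forall>\<^sub>F N in sequentially.
      qpoch q (2 * N) / (qpoch q (N + n) * qpoch q (N - n)) = qbinom q (2 * N) (N + n)"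
    using eventually_ge_at_top[of n]
    by eventually_elim (simp add: qbinom_eq_quotient[OF q] mult_2)
  ultimately show ?thesis
    using L(1) by (simp add: filterlim_cong[OF refl refl])
qed

section \<open>Convergence of the two half-series\<close>

text \<open>Ratio test: the factor from term \<open>n\<close> to the next has norm
  \<open>norm z * norm q ^ n\<close>, which tends to 0.\<close>

lemma summable_theta_term:
  assumes q: "norm q < 1"
  shows "summable (\<lambda>n. norm (theta_term q z (int n)))"
proof -
  have "(\<lambda>n. norm z * norm q ^ n) \<longlonglongrightarrow> norm z * 0"
    using q by (intro tendsto_mult tendsto_const LIMSEQ_realpow_zero) auto
  then have "\<forall>\<^sub>F n in sequentially. norm z * norm q ^ n < 1 / 2"
    by (intro order_tendstoD) auto
  then obtain N where N: "\<And>n. n \<ge> N \<Longrightarrow> norm z * norm q ^ n < 1 / 2"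
    by (auto simp: eventually_at_top_linorder)
  have "norm (theta_term q z (int (Suc n))) = (norm z * norm q ^ n) * norm (theta_term q z (int n))" for n
    unfolding theta_term_of_nat triangle_Suc by (simp add: norm_mult norm_power power_add)
  then have "norm (norm (theta_term q z (int (Suc n)))) \<le> 1 / 2 * norm (norm (theta_term q z (int n)))"
    if "n \<ge> N" for n
    using mult_right_mono[OF less_imp_le[OF N[OF that]] norm_ge_zero[of "theta_term q z (int n)"]] by simp
  then show ?thesis
    by (rule summable_ratio_test[of "1/2" N, rotated]) auto
qed

text \<open>Tannery's theorem, with the uniform bound on \<open>qbinom\<close> giving the majorant.
  It serves \<open>w = z\<close> with \<open>j = 0\<close> and \<open>w = q / z\<close> with
  \<open>j = 1\<close>; the latter offset avoids counting the central term twice.\<close>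

lemma theta_term_qbinom_tendsto:
  assumes q: "norm q < 1" and L: "L \<noteq> 0" "qpoch q \<longlonglongrightarrow> L"
  shows "(\<lambda>N. \<Sum>n. theta_term q w (int (n + j)) * qbinom q (2 * N) (N + (n + j)))
    \<longlonglongrightarrow> (\<Sum>n. theta_term q w (int (n + j)) * (1 / L))"
proof -
  obtain B where B: "\<And>m k. norm (qbinom q m k) \<le> B"
    using qbinom_bounded[OF q] by blast
  have M: "summable (\<lambda>n. norm (theta_term q w (int (n + j))) * B)"
    by (rule summable_mult2[OF summable_ignore_initial_segment[OF summable_theta_term[OF q]]])
  have bound: "\<forall>\<^sub>F (n, N) in at_top \<times>\<^sub>F sequentially.
      norm (theta_term q w (int (n + j)) * qbinom q (2 * N) (N + (n + j)))
        \<le> norm (theta_term q w (int (n + j))) * B"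
    unfolding norm_mult by (intro always_eventually) (simp add: B mult_left_mono)
  have lim: "(\<lambda>N. theta_term q w (int (n + j)) * qbinom q (2 * N) (N + (n + j)))
      \<longlonglongrightarrow> theta_term q w (int (n + j)) * (1 / L)" for n
    by (rule tendsto_mult[OF tendsto_const qbinom_central_tendsto[OF q L]])
  show ?thesis
    by (rule tannerys_theorem[OF lim bound M sequentially_bot, THEN conjunct2, THEN conjunct2])
qed

lemma has_sum_theta_term:
  assumes q: "norm q < 1" and z: "z \<noteq> 0"
  shows "(theta_term q z has_sum
    ((\<Sum>n. theta_term q z (int n)) + (\<Sum>n. theta_term q (q / z) (int (n + 1))))) UNIV"
proof -
  have s: "summable (\<lambda>n. norm (theta_term q (q / z) (int (n + 1))))"
    by (rule summable_ignore_initial_segment[OF summable_theta_term[OF q]])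
  have "bij_betw int UNIV {0..}"
    by (rule bij_betwI[of _ _ _ nat]) auto
  then have 1: "(theta_term q z has_sum (\<Sum>n. theta_term q z (int n))) {0..}"
    using norm_summable_imp_has_sum[OF summable_theta_term[OF q]
        summable_sums[OF summable_norm_cancel[OF summable_theta_term[OF q]]]]
    by (simp only: has_sum_reindex_bij_betw)
  have "bij_betw (\<lambda>n. - int (n + 1)) UNIV {..<0}"
    by (rule bij_betwI[of _ _ _ "\<lambda>n. nat (- n - 1)"]) auto
  then have 2: "(theta_term q z has_sum (\<Sum>n. theta_term q (q / z) (int (n + 1)))) {..<0}"
    using norm_summable_imp_has_sum[OF s summable_sums[OF summable_norm_cancel[OF s]]]
      has_sum_reindex_bij_betw[of "\<lambda>n. - int (n + 1)" UNIV "{..<0}" "theta_term q z"]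
    unfolding theta_term_minus[OF z] by blast
  have "{0..} \<union> {..<0} = (UNIV :: int set)" by auto
  then show ?thesis
    using has_sum_Un_disjoint[OF 1 2] by force
qed

section \<open>Symmetric form and passage to the limit\<close>

lemma sum_split_center:
  fixes f :: "nat \<Rightarrow> 'a::comm_monoid_add"
  shows "(\<Sum>k\<le>N + N. f k) = (\<Sum>n\<le>N. f (N + n)) + (\<Sum>n<N. f (N - Suc n))"
proof -
  have "(\<Sum>k\<le>N + N. f k) = (\<Sum>k<N. f k) + (\<Sum>k=N..N + N. f k)"
    by (subst sum.union_disjoint[symmetric]) (auto intro!: sum.cong)
  also have "(\<Sum>k<N. f k) = (\<Sum>n<N. f (N - Suc n))"
    by (rule sum.nat_diff_reindex[symmetric])
  also have "(\<Sum>k=N..N + N. f k) = (\<Sum>n\<le>N. f (N + n))"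
    by (rule sum.reindex_bij_witness[of _ "\<lambda>n. N + n" "\<lambda>k. k - N"]) auto
  finally show ?thesis by (simp add: add.commute)
qed

text \<open>With \<open>M = N\<close> the coefficients are symmetric about \<open>N\<close>, so both
  halves carry the same ones. They vanish beyond \<open>2 * N\<close>, so the finite sums can be
  written as the series that Tannery's theorem handles.\<close>

lemma finite_jacobi_triple_product_symmetric:
  assumes q: "norm q < 1" and z: "z \<noteq> 0"
  shows "(\<Prod>i<N. 1 - z * q ^ i) * (\<Prod>i<N. 1 - q ^ Suc i / z)
    = (\<Sum>n. theta_term q z (int (n + 0)) * qbinom q (2 * N) (N + (n + 0)))
      + (\<Sum>n. theta_term q (q / z) (int (n + 1)) * qbinom q (2 * N) (N + (n + 1)))"
proof -
  have sym: "qbinom q (2 * N) (N - Suc n) = qbinom q (2 * N) (N + (n + 1))" if "n < N" for n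
    using that q by (simp add: qbinom_eq_quotient mult.commute)
  have idx: "int (N - Suc n) - int N = - int (n + 1)" if "n < N" for n
    using that by simp
  have idx': "int (N + n) - int N = int n" for n
    by simp
  have "(\<Prod>i<N. 1 - z * q ^ i) * (\<Prod>i<N. 1 - q ^ Suc i / z)
      = (\<Sum>n\<le>N. theta_term q z (int (n + 0)) * qbinom q (2 * N) (N + (n + 0)))
        + (\<Sum>n<N. theta_term q (q / z) (int (n + 1)) * qbinom q (2 * N) (N + (n + 1)))"
    unfolding finite_jacobi_triple_product[OF z] sum_split_center
    by (intro arg_cong2[of _ _ _ _ "(+)"] sum.cong)
      (simp_all add: idx idx' mult_2[symmetric] sym theta_term_minus[OF z, symmetric] del: of_nat_Suc of_nat_add)
  also have "(\<Sum>n\<le>N. theta_term q z (int (n + 0)) * qbinom q (2 * N) (N + (n + 0)))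
      = (\<Sum>n. theta_term q z (int (n + 0)) * qbinom q (2 * N) (N + (n + 0)))"
    by (rule suminf_finite[symmetric]) (auto simp: qbinom_eq_0)
  also have "(\<Sum>n<N. theta_term q (q / z) (int (n + 1)) * qbinom q (2 * N) (N + (n + 1)))
      = (\<Sum>n. theta_term q (q / z) (int (n + 1)) * qbinom q (2 * N) (N + (n + 1)))"
    by (rule suminf_finite[symmetric]) (auto simp: qbinom_eq_0)
  finally show ?thesis .
qed

(* n (n - 1) is even and nonnegative for every integer n, so "div" and "nat" are exact here;
   the natural-number power satisfies 0 ^ 0 = 1.
   The product is re-indexed from m >= 1 to m >= 0. *)
theorem theorem1p1p1:
  fixes q z :: complex
  assumes "norm q < 1" and "z \<noteq> 0"
  shows "(\<lambda>n::int. (-1) powi n * z powi n * q ^ nat (n * (n - 1) div 2)) summable_on UNIV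
    \<and> convergent_prod (\<lambda>m::nat. (1 - q ^ (m + 1)) * (1 - z * q ^ m) * (1 - z powi (-1) * q ^ (m + 1)))
    \<and> (\<Sum>\<^sub>\<infinity>n::int. (-1) powi n * z powi n * q ^ nat (n * (n - 1) div 2))
      = (\<Prod>m::nat. (1 - q ^ (m + 1)) * (1 - z * q ^ m) * (1 - z powi (-1) * q ^ (m + 1)))"
proof -
  define S where "S = (\<Sum>n. theta_term q z (int n)) + (\<Sum>n. theta_term q (q / z) (int (n + 1)))"
  define P where "P m = (1 - q ^ (m + 1)) * (1 - z * q ^ m) * (1 - z powi (-1) * q ^ (m + 1))" for m :: nat
  have sum: "(theta_term q z has_sum S) UNIV"
    unfolding S_def using assms by (rule has_sum_theta_term)
  have geom: "convergent_prod (\<lambda>m. 1 - c * q ^ m)" for c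
    by (intro abs_convergent_prod_imp_convergent_prod abs_convergent_prod_one_minus_geometric assms)
  \<comment> \<open>Needs its own proof: a limit of partial products does not yield
    \<open>convergent_prod\<close> when it is 0, as happens for \<open>z = 1\<close>.\<close>
  have conv: "convergent_prod P"
    unfolding P_def using geom[of q] geom[of "z powi (-1) * q"]
    by (intro convergent_prod_mult geom) (simp_all add: mult.assoc)
  obtain L where L: "L \<noteq> 0" "qpoch q \<longlonglongrightarrow> L"
    using qpoch_convergent[OF assms(1)] .
  have P_eq: "(\<Prod>m<N. P m) = qpoch q N * ((\<Prod>i<N. 1 - z * q ^ i) * (\<Prod>i<N. 1 - q ^ Suc i / z))" for N
    unfolding P_def qpoch_def prod.distrib by (simp add: power_int_minus divide_inverse ac_simps)
  have summable: "summable (\<lambda>n. theta_term q w (int (n + j)))" for w j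
    using summable_norm_cancel[OF summable_theta_term[OF assms(1)]]
    by (rule summable_ignore_initial_segment)
  have "(\<lambda>N. \<Prod>m<N. P m) \<longlonglongrightarrow> L * ((\<Sum>n. theta_term q z (int (n + 0)) * (1 / L))
      + (\<Sum>n. theta_term q (q / z) (int (n + 1)) * (1 / L)))"
    unfolding P_eq finite_jacobi_triple_product_symmetric[OF assms]
    by (intro tendsto_mult L(2) tendsto_add theta_term_qbinom_tendsto[OF assms(1) L])
  \<comment> \<open>Summability lets the constant \<open>1 / L\<close> leave both series and cancel
    against the limit of \<open>qpoch q\<close>.\<close>
  also have "L * ((\<Sum>n. theta_term q z (int (n + 0)) * (1 / L))
      + (\<Sum>n. theta_term q (q / z) (int (n + 1)) * (1 / L))) = S"
    unfolding suminf_mult2[OF summable, symmetric] using L(1) by (simp add: S_def field_simps)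
  finally have "(\<lambda>N. \<Prod>m<N. P m) \<longlonglongrightarrow> S" .
  then have "(\<lambda>N. \<Prod>m\<le>N. P m) \<longlonglongrightarrow> S"
    by (subst (asm) LIMSEQ_lessThan_iff_atMost)
  then have "prodinf P = S"
    using convergent_prod_LIMSEQ[OF conv] LIMSEQ_unique by blast
  moreover have "theta_term q z summable_on UNIV" "infsum (theta_term q z) UNIV = S"
    using sum by (auto simp: summable_on_def infsumI)
  ultimately show ?thesis
    using conv unfolding P_def theta_term_def by simp
qed

end
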